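(* Let $G$ be a finite simple connected graph of order $n\geq 3$, and let $S(G)$ be its subdivision graph. Then $D''(G)=D(S(G))$.
   Context: The subdivision graph $S(G)$ of $G=(V(G),E(G))$ is the bipartite graph with vertex set $V(G)\cup E(G)$ (disjoint union) in which $v\in V(G)$ and $e\in E(G)$ are adjacent if and only if $v$ is incident with $e$ in $G$ (and there are no other adjacencies). The distinguishing number $D(H)$ of a graph $H$ is the least integer $r$ such that there is a (not necessarily proper) vertex coloring $h:V(H)\to\{1,\dots,r\}$ for which the only automorphism $\psi$ of $H$ with $h(\psi(v))=h(v)$ for all $v\in V(H)$ is the identity. The total distinguishing number $D''(G)$ is the least integer $d$ such that there is a (not necessarily proper) total coloring $c:V(G)\cup E(G)\to\{1,\dots,d\}$ for which the only automorphism of $G$ that maps each vertex to a vertex of the same color and each edge to an edge of the same color is the identity. *)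

theory Defs
  imports Main
begin

text \<open>A graph is a pair of a vertex set and an edge set; an edge is the two-element set of its ends.\<close>

type_synonym 'a graph = "'a set \<times> 'a set set"

abbreviation verts :: "'a graph \<Rightarrow> 'a set" where
  "verts G \<equiv> fst G"

abbreviation edges :: "'a graph \<Rightarrow> 'a set set" where
  "edges G \<equiv> snd G"

definition finite_simple_graph :: "'a graph \<Rightarrow> bool" where
  "finite_simple_graph G \<longleftrightarrow>
     finite (verts G) \<and> (\<forall>e\<in>edges G. e \<subseteq> verts G \<and> card e = 2)"

definition connected_graph :: "'a graph \<Rightarrow> bool" where
  "connected_graph G \<longleftrightarrow>
     (\<forall>u\<in>verts G. \<forall>v\<in>verts G. (u, v) \<in> {(x, y). {x, y} \<in> edges G}\<^sup>*)"

text \<open>Automorphisms are functions on the whole type, of which only the values on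
  the vertex set matter; accordingly, identity below means identity on the vertex set.\<close>

definition graph_automorphism :: "'a graph \<Rightarrow> ('a \<Rightarrow> 'a) \<Rightarrow> bool" where
  "graph_automorphism G \<psi> \<longleftrightarrow>
     bij_betw \<psi> (verts G) (verts G) \<and>
     (\<forall>u\<in>verts G. \<forall>v\<in>verts G. {\<psi> u, \<psi> v} \<in> edges G \<longleftrightarrow> {u, v} \<in> edges G)"

definition distinguishing_coloring :: "'a graph \<Rightarrow> ('a \<Rightarrow> nat) \<Rightarrow> bool" where
  "distinguishing_coloring H h \<longleftrightarrow>
     (\<forall>\<psi>. graph_automorphism H \<psi> \<and> (\<forall>v\<in>verts H. h (\<psi> v) = h v)
        \<longrightarrow> (\<forall>v\<in>verts H. \<psi> v = v))"

definition distinguishing_number :: "'a graph \<Rightarrow> nat" where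
  "distinguishing_number H =
     (LEAST r. \<exists>h. h ` verts H \<subseteq> {1..r} \<and> distinguishing_coloring H h)"

text \<open>The disjoint union of vertices and edges is \<^term>\<open>verts G <+> edges G\<close>.
  An automorphism \<open>\<psi>\<close> maps the edge \<open>e\<close> to the image \<^term>\<open>\<psi> ` e\<close>.\<close>

definition distinguishing_total_coloring :: "'a graph \<Rightarrow> ('a + 'a set \<Rightarrow> nat) \<Rightarrow> bool" where
  "distinguishing_total_coloring G c \<longleftrightarrow>
     (\<forall>\<psi>. graph_automorphism G \<psi> \<and>
           (\<forall>v\<in>verts G. c (Inl (\<psi> v)) = c (Inl v)) \<and>
           (\<forall>e\<in>edges G. c (Inr (\<psi> ` e)) = c (Inr e))
        \<longrightarrow> (\<forall>v\<in>verts G. \<psi> v = v))"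

definition total_distinguishing_number :: "'a graph \<Rightarrow> nat" where
  "total_distinguishing_number G =
     (LEAST d. \<exists>c. c ` (verts G <+> edges G) \<subseteq> {1..d} \<and> distinguishing_total_coloring G c)"

definition subdivision_graph :: "'a graph \<Rightarrow> ('a + 'a set) graph" where
  "subdivision_graph G =
     (verts G <+> edges G,
      {{Inl v, Inr e} | v e. v \<in> verts G \<and> e \<in> edges G \<and> v \<in> e})"

lemma finite_edges: "finite_simple_graph G \<Longrightarrow> finite (edges G)"
  unfolding finite_simple_graph_def
  by (rule finite_subset[of _ "Pow (verts G)"]) auto

lemma finite_simple_subdivision_graph:
  assumes "finite_simple_graph G"
  shows "finite_simple_graph (subdivision_graph G)"
  using assms finite_edges[OF assms] unfolding finite_simple_graph_def subdivision_graph_def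
  by (auto simp: card_insert_if)

text \<open>On finite graphs the sets of admissible numbers of colors are nonempty, so both minima
  are attained.\<close>

lemma ex_coloring_inj:
  assumes "finite A"
  shows "\<exists>(f :: 'b \<Rightarrow> nat) r. f ` A \<subseteq> {1..r} \<and> inj_on f A"
proof -
  obtain f where "bij_betw f A {0..<card A}"
    using ex_bij_betw_finite_nat[OF assms] by blast
  then have "f x < card A" if "x \<in> A" for x
    using that bij_betwE by fastforce
  with \<open>bij_betw f A {0..<card A}\<close>
  have "(Suc \<circ> f) ` A \<subseteq> {1..card A} \<and> inj_on (Suc \<circ> f) A"
    by (auto simp: bij_betw_def inj_on_def Suc_le_eq)
  then show ?thesis by blast
qed

lemma distinguishing_number_attained:
  assumes "finite_simple_graph H"
  shows "\<exists>h. h ` verts H \<subseteq> {1..distinguishing_number H} \<and> distinguishing_coloring H h"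
proof -
  obtain f :: "'a \<Rightarrow> nat" and r where f: "f ` verts H \<subseteq> {1..r}" "inj_on f (verts H)"
    using ex_coloring_inj[of "verts H"] assms unfolding finite_simple_graph_def by blast
  have "distinguishing_coloring H f"
    unfolding distinguishing_coloring_def graph_automorphism_def
  proof (intro allI impI ballI, elim conjE)
    fix \<psi> v
    assume "bij_betw \<psi> (verts H) (verts H)" "v \<in> verts H"
      and "\<forall>v\<in>verts H. f (\<psi> v) = f v"
    then have "\<psi> v \<in> verts H" "f (\<psi> v) = f v"
      by (auto dest: bij_betwE)
    with \<open>v \<in> verts H\<close> show "\<psi> v = v"
      using inj_onD[OF f(2)] by blast
  qed
  with f(1) have "\<exists>h. h ` verts H \<subseteq> {1..r} \<and> distinguishing_coloring H h"
    by blast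
  then show ?thesis
    unfolding distinguishing_number_def by (rule LeastI)
qed

lemma total_distinguishing_number_attained:
  assumes "finite_simple_graph G"
  shows "\<exists>c. c ` (verts G <+> edges G) \<subseteq> {1..total_distinguishing_number G}
           \<and> distinguishing_total_coloring G c"
proof -
  have "finite (verts G <+> edges G)"
    using assms finite_edges[OF assms] unfolding finite_simple_graph_def by simp
  then obtain f :: "'a + 'a set \<Rightarrow> nat" and r
    where f: "f ` (verts G <+> edges G) \<subseteq> {1..r}" "inj_on f (verts G <+> edges G)"
    using ex_coloring_inj[of "verts G <+> edges G"] by auto
  have "distinguishing_total_coloring G f"
    unfolding distinguishing_total_coloring_def graph_automorphism_def
  proof (intro allI impI ballI, elim conjE)
    fix \<psi> v
    assume "bij_betw \<psi> (verts G) (verts G)" "v \<in> verts G"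
      and "\<forall>v\<in>verts G. f (Inl (\<psi> v)) = f (Inl v)"
    then have "\<psi> v \<in> verts G" "f (Inl (\<psi> v)) = f (Inl v)"
      by (auto dest: bij_betwE)
    with \<open>v \<in> verts G\<close> show "\<psi> v = v"
      using inj_onD[OF f(2), of "Inl (\<psi> v)" "Inl v"] by auto
  qed
  with f(1) have "\<exists>c. c ` (verts G <+> edges G) \<subseteq> {1..r} \<and> distinguishing_total_coloring G c"
    by blast
  then show ?thesis
    unfolding total_distinguishing_number_def by (rule LeastI)
qed

end

theory Submission
  imports Defs
begin

text \<open>A color-preserving automorphism of \<open>S(G)\<close> that maps some vertex of \<open>G\<close> to a vertex of \<open>G\<close>
  is, by connectedness, induced by an automorphism of \<open>G\<close>; so the two notions of distinguishing
  coloring can only differ when some automorphism of \<open>S(G)\<close> interchanges the vertices and the edges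
  of \<open>G\<close>. Then every vertex of \<open>G\<close> has degree 2. In this case \<open>G\<close> has a nontrivial automorphism
  (reverse a longest path, which closes up to a Hamiltonian cycle), so \<open>D''(G) \<ge> 2\<close>, while \<open>S(G)\<close>
  is distinguished by two colors: give one color to \<open>v\<^sub>0\<close>, \<open>v\<^sub>0v\<^sub>1\<close> and \<open>v\<^sub>1v\<^sub>2\<close>, where
  \<open>v\<^sub>0, v\<^sub>1, v\<^sub>2\<close> is a path of \<open>G\<close>, and the other color to everything else.\<close>

section \<open>Edges, neighbourhoods and induction along walks\<close>

definition neighbours :: "'a graph \<Rightarrow> 'a \<Rightarrow> 'a set" where
  "neighbours G v = {w. {v, w} \<in> edges G}"

lemma edgeD:
  assumes "finite_simple_graph G" "{u, v} \<in> edges G"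
  shows "u \<in> verts G" "v \<in> verts G" "u \<noteq> v"
  using assms unfolding finite_simple_graph_def by fastforce+

lemma edge_eq:
  assumes "finite_simple_graph G" "e \<in> edges G" "u \<in> e" "v \<in> e" "u \<noteq> v"
  shows "e = {u, v}"
proof -
  have "card e = 2" using assms unfolding finite_simple_graph_def by blast
  then show ?thesis using assms(3-5) by (auto simp: card_2_iff)
qed

lemma edge_other_end:
  assumes "finite_simple_graph G" "e \<in> edges G" "u \<in> e"
  obtains v where "e = {u, v}" "v \<noteq> u"
proof -
  have "card e = 2" using assms unfolding finite_simple_graph_def by blast
  then show ?thesis using assms(3) that by (auto simp: card_2_iff doubleton_eq_iff)
qed

text \<open>Connectedness as a spreading principle: what holds at one vertex and passes along every
  edge holds everywhere. It will be applied to the side of S(G) that vertices are mapped to, to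
  being fixed, and to lying on a longest path.\<close>

lemma connected_induct [consumes 3, case_names base step]:
  assumes "connected_graph G" "u \<in> verts G" "v \<in> verts G"
    and "P u"
    and "\<And>x y. {x, y} \<in> edges G \<Longrightarrow> P x \<Longrightarrow> P y"
  shows "P v"
proof -
  have "(u, v) \<in> {(x, y). {x, y} \<in> edges G}\<^sup>*"
    using assms(1-3) unfolding connected_graph_def by blast
  then show ?thesis
    by (induction rule: rtrancl_induct) (use assms(4,5) in auto)
qed

lemma automorphism_neighbours:
  assumes "finite_simple_graph G" "graph_automorphism G \<psi>" "v \<in> verts G"
  shows "neighbours G (\<psi> v) = \<psi> ` neighbours G v"
proof -
  have b: "bij_betw \<psi> (verts G) (verts G)"
    and e: "\<And>u w. u \<in> verts G \<Longrightarrow> w \<in> verts G \<Longrightarrow> {\<psi> u, \<psi> w} \<in> edges G \<longleftrightarrow> {u, w} \<in> edges G"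
    using assms(2) unfolding graph_automorphism_def by auto
  have "y \<in> \<psi> ` neighbours G v" if "{\<psi> v, y} \<in> edges G" for y
  proof -
    have "y \<in> \<psi> ` verts G" using edgeD(2)[OF assms(1) that] b by (simp add: bij_betw_def)
    then show ?thesis using that e[OF assms(3)] by (auto simp: neighbours_def)
  qed
  moreover have "{\<psi> v, \<psi> w} \<in> edges G" if "{v, w} \<in> edges G" for w
    using that e[OF edgeD(1,2)[OF assms(1) that]] by simp
  ultimately show ?thesis by (auto simp: neighbours_def)
qed

text \<open>Invariance of degrees. It is meant for S(G), where every edge of G has degree 2 and
  every vertex of G keeps its degree.\<close>

lemma card_automorphism_neighbours:
  assumes "finite_simple_graph G" "graph_automorphism G \<psi>" "v \<in> verts G"
  shows "card (neighbours G (\<psi> v)) = card (neighbours G v)"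
proof -
  have "neighbours G v \<subseteq> verts G"
    using edgeD(2)[OF assms(1)] by (auto simp: neighbours_def)
  then have "inj_on \<psi> (neighbours G v)"
    using assms(2) unfolding graph_automorphism_def bij_betw_def by (blast intro: inj_on_subset)
  then show ?thesis
    by (simp add: automorphism_neighbours[OF assms] card_image)
qed

section \<open>Automorphisms of the subdivision graph\<close>

lemma verts_subdivision [simp]: "verts (subdivision_graph G) = verts G <+> edges G"
  by (simp add: subdivision_graph_def)

lemma edges_subdivision [simp]:
  "{Inl v, Inr e} \<in> edges (subdivision_graph G) \<longleftrightarrow> v \<in> verts G \<and> e \<in> edges G \<and> v \<in> e"
  "{Inr e, Inl v} \<in> edges (subdivision_graph G) \<longleftrightarrow> v \<in> verts G \<and> e \<in> edges G \<and> v \<in> e"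
  "{Inl v, Inl w} \<notin> edges (subdivision_graph G)"
  "{Inr e, Inr f} \<notin> edges (subdivision_graph G)"
  by (auto simp: subdivision_graph_def doubleton_eq_iff)

lemma neighbours_subdivision_Inr:
  assumes "finite_simple_graph G" "e \<in> edges G"
  shows "neighbours (subdivision_graph G) (Inr e) = Inl ` e"
proof -
  have "e \<subseteq> verts G" using assms by (simp add: finite_simple_graph_def)
  then have "x \<in> neighbours (subdivision_graph G) (Inr e) \<longleftrightarrow> x \<in> Inl ` e" for x
    using assms(2) by (cases x) (auto simp: neighbours_def)
  then show ?thesis by blast
qed

lemma neighbours_subdivision_Inl:
  assumes "finite_simple_graph G" "v \<in> verts G"
  shows "neighbours (subdivision_graph G) (Inl v) = (\<lambda>w. Inr {v, w}) ` neighbours G v"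
proof -
  have "x \<in> neighbours (subdivision_graph G) (Inl v) \<longleftrightarrow>
      x \<in> (\<lambda>w. Inr {v, w}) ` neighbours G v" for x
  proof (cases x)
    case (Inr e)
    have "(e \<in> edges G \<and> v \<in> e) \<longleftrightarrow> (\<exists>w. {v, w} \<in> edges G \<and> e = {v, w})"
      by (metis assms(1) edge_other_end insertI1)
    then show ?thesis using Inr assms(2) by (auto simp: neighbours_def)
  qed (auto simp: neighbours_def)
  then show ?thesis by blast
qed

lemma card_neighbours_subdivision_Inl:
  assumes "finite_simple_graph G" "v \<in> verts G"
  shows "card (neighbours (subdivision_graph G) (Inl v)) = card (neighbours G v)"
proof -
  have "inj_on (\<lambda>w. Inr {v, w} :: 'a + 'a set) (neighbours G v)"
    by (auto simp: inj_on_def doubleton_eq_iff)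
  then show ?thesis
    by (simp add: neighbours_subdivision_Inl[OF assms] card_image)
qed

lemma card_neighbours_subdivision_Inr:
  assumes "finite_simple_graph G" "e \<in> edges G"
  shows "card (neighbours (subdivision_graph G) (Inr e)) = 2"
  using assms by (simp add: neighbours_subdivision_Inr card_image finite_simple_graph_def)

text \<open>Adjacent vertices x, y of G have the common neighbour \<open>Inr {x, y}\<close> in S(G),
  so their images have a common neighbour too. Since S(G) is bipartite, both images lie on the same
  side, and connectedness does the rest.\<close>

lemma automorphism_subdivision_isl:
  assumes "finite_simple_graph G" "connected_graph G"
    and aut: "graph_automorphism (subdivision_graph G) \<psi>"
    and "u \<in> verts G" "v \<in> verts G" "isl (\<psi> (Inl u))"
  shows "isl (\<psi> (Inl v))"
  using assms(2,4,5)
proof (induction rule: connected_induct)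
  case base
  show ?case by fact
next
  case (step x y)
  note xy = edgeD[OF assms(1) step(1)]
  have "{\<psi> (Inl x), \<psi> (Inr {x, y})} \<in> edges (subdivision_graph G)"
    and "{\<psi> (Inl y), \<psi> (Inr {x, y})} \<in> edges (subdivision_graph G)"
    using aut xy step(1) unfolding graph_automorphism_def by (simp_all add: InlI InrI)
  then show ?case using step(2)
    by (cases "\<psi> (Inl x)"; cases "\<psi> (Inl y)"; cases "\<psi> (Inr {x, y})") auto
qed

text \<open>If one vertex of G is mapped to a vertex, then all are. The image of an edge is then
  incident with the distinct images of both its ends, which leaves only one candidate.\<close>

lemma automorphism_subdivision_induced:
  assumes fsg: "finite_simple_graph G" and "connected_graph G"
    and aut: "graph_automorphism (subdivision_graph G) \<psi>"
    and "u \<in> verts G" "isl (\<psi> (Inl u))"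
  obtains \<phi> where "graph_automorphism G \<phi>"
    "\<And>v. v \<in> verts G \<Longrightarrow> \<psi> (Inl v) = Inl (\<phi> v)"
    "\<And>e. e \<in> edges G \<Longrightarrow> \<psi> (Inr e) = Inr (\<phi> ` e)"
proof -
  \<comment> \<open>On \<open>verts G\<close> the image is an \<open>Inl\<close>, so
    \<open>projl\<close> reads off its content; the values elsewhere are irrelevant for
    automorphisms.\<close>
  define \<phi> where "\<phi> v = projl (\<psi> (Inl v))" for v
  let ?S = "subdivision_graph G"
  have bij: "bij_betw \<psi> (verts G <+> edges G) (verts G <+> edges G)"
    and adj: "\<And>x y. x \<in> verts G <+> edges G \<Longrightarrow> y \<in> verts G <+> edges G \<Longrightarrow>
      {\<psi> x, \<psi> y} \<in> edges ?S \<longleftrightarrow> {x, y} \<in> edges ?S"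
    using aut unfolding graph_automorphism_def by auto
  have l: "\<psi> (Inl v) = Inl (\<phi> v)" if "v \<in> verts G" for v
    using automorphism_subdivision_isl[OF assms(1-4) that assms(5)] by (simp add: \<phi>_def)
  have mem: "\<phi> v \<in> verts G" if "v \<in> verts G" for v
    using bij_betwE[OF bij, rule_format, of "Inl v"] l[OF that] that by auto
  have inj: "inj_on \<phi> (verts G)"
  proof (rule inj_onI)
    fix x y assume "x \<in> verts G" "y \<in> verts G" "\<phi> x = \<phi> y"
    then have "\<psi> (Inl x) = \<psi> (Inl y)" by (simp add: l)
    then show "x = y"
      using inj_onD[OF bij_betw_imp_inj_on[OF bij], of "Inl x" "Inl y"]
        \<open>x \<in> verts G\<close> \<open>y \<in> verts G\<close> by auto
  qed
  have bij\<phi>: "bij_betw \<phi> (verts G) (verts G)"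
    using inj mem fsg unfolding finite_simple_graph_def bij_betw_def
    by (simp add: endo_inj_surj image_subsetI)
  have r: "\<psi> (Inr e) = Inr (\<phi> ` e) \<and> \<phi> ` e \<in> edges G" if e: "e \<in> edges G" for e
  proof -
    obtain x y where xy: "e = {x, y}" "x \<noteq> y"
      using fsg e unfolding finite_simple_graph_def by (meson card_2_iff)
    have v: "x \<in> verts G" "y \<in> verts G" using edgeD[OF fsg] e xy by auto
    have "{Inl (\<phi> x), \<psi> (Inr e)} \<in> edges ?S" "{Inl (\<phi> y), \<psi> (Inr e)} \<in> edges ?S"
      using adj[of "Inl x" "Inr e"] adj[of "Inl y" "Inr e"] e xy v by (auto simp: l)
    then obtain f where f: "\<psi> (Inr e) = Inr f" "f \<in> edges G" "\<phi> x \<in> f" "\<phi> y \<in> f"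
      by (cases "\<psi> (Inr e)") auto
    have "\<phi> x \<noteq> \<phi> y" using inj_onD[OF inj] v xy by blast
    then have "f = \<phi> ` e" using edge_eq[OF fsg f(2-4)] xy by simp
    with f show ?thesis by simp
  qed
  \<comment> \<open>By surjectivity of \<psi> the edge between the images has a preimage in S(G). It
    is adjacent to both \<open>Inl x\<close> and \<open>Inl y\<close>, hence is itself an edge of G
    with ends x and y.\<close>
  have edge_back: "{x, y} \<in> edges G"
    if v: "x \<in> verts G" "y \<in> verts G" and e: "{\<phi> x, \<phi> y} \<in> edges G" for x y
  proof -
    have "Inr {\<phi> x, \<phi> y} \<in> \<psi> ` (verts G <+> edges G)"
      using bij e by (simp add: bij_betw_def InrI)
    then obtain z where z: "z \<in> verts G <+> edges G" "\<psi> z = Inr {\<phi> x, \<phi> y}" by force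
    then have "{Inl x, z} \<in> edges ?S" "{Inl y, z} \<in> edges ?S"
      using adj[of "Inl x" z] adj[of "Inl y" z] v e mem by (auto simp: l)
    then obtain f where "f \<in> edges G" "x \<in> f" "y \<in> f"
      by (cases z) auto
    moreover have "x \<noteq> y" using edgeD(3)[OF fsg e] by auto
    ultimately show ?thesis using edge_eq[OF fsg] by metis
  qed
  have "graph_automorphism G \<phi>"
    unfolding graph_automorphism_def using bij\<phi> edge_back r[THEN conjunct2] by force
  then show ?thesis using that l r by blast
qed

lemma bij_betw_map_sum:
  assumes "bij_betw f A B" "bij_betw g C D"
  shows "bij_betw (map_sum f g) (A <+> C) (B <+> D)"
proof -
  have "inj_on (map_sum f g) (A <+> C)"
    using assms by (auto intro!: inj_onI simp: bij_betw_def dest: inj_onD)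
  moreover have "map_sum f g ` (A <+> C) = f ` A <+> g ` C"
    by (simp add: Plus_def image_Un image_image)
  ultimately show ?thesis using assms by (simp add: bij_betw_def)
qed

text \<open>Letting \<phi> act on edges by images preserves incidence because \<phi> is injective,
  and permutes the edges because there are finitely many.\<close>

lemma automorphism_subdivision_of_automorphism:
  assumes fsg: "finite_simple_graph G" and aut: "graph_automorphism G \<phi>"
  shows "graph_automorphism (subdivision_graph G) (map_sum \<phi> ((`) \<phi>))"
proof -
  have bij: "bij_betw \<phi> (verts G) (verts G)"
    and adj: "\<And>x y. x \<in> verts G \<Longrightarrow> y \<in> verts G \<Longrightarrow> {\<phi> x, \<phi> y} \<in> edges G \<longleftrightarrow> {x, y} \<in> edges G"
    using aut unfolding graph_automorphism_def by auto
  note inj = bij_betw_imp_inj_on[OF bij]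
  have sub: "e \<subseteq> verts G" if "e \<in> edges G" for e
    using that fsg by (simp add: finite_simple_graph_def)
  have mem: "\<phi> v \<in> verts G" if "v \<in> verts G" for v using bij_betwE[OF bij] that by blast
  have img: "\<phi> ` e \<in> edges G" if e: "e \<in> edges G" for e
  proof -
    obtain x y where "e = {x, y}" using fsg e unfolding finite_simple_graph_def by (meson card_2_iff)
    then show ?thesis using adj[of x y] sub[OF e] e by auto
  qed
  have "inj_on ((`) \<phi>) (edges G)"
    using inj sub by (intro inj_onI) (simp add: inj_on_image_eq_iff)
  then have "bij_betw ((`) \<phi>) (edges G) (edges G)"
    using finite_edges[OF fsg] img by (simp add: bij_betw_def endo_inj_surj image_subsetI)
  with bij have "bij_betw (map_sum \<phi> ((`) \<phi>)) (verts G <+> edges G) (verts G <+> edges G)"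
    by (rule bij_betw_map_sum)
  moreover have "{map_sum \<phi> ((`) \<phi>) x, map_sum \<phi> ((`) \<phi>) y} \<in> edges (subdivision_graph G) \<longleftrightarrow>
      {x, y} \<in> edges (subdivision_graph G)"
    if "x \<in> verts G <+> edges G" "y \<in> verts G <+> edges G" for x y
  proof -
    have "\<phi> v \<in> \<phi> ` e \<longleftrightarrow> v \<in> e" if "v \<in> verts G" "e \<in> edges G" for v e
      using inj_on_image_mem_iff[OF inj that(1) sub[OF that(2)]] .
    then show ?thesis using that mem img by (cases x; cases y) auto
  qed
  ultimately show ?thesis unfolding graph_automorphism_def by simp
qed

text \<open>A total coloring of G and a coloring of S(G) are the same function. A color-preserving
  automorphism of G extends to one of S(G), which must be the identity.\<close>

lemma distinguishing_total_coloring_if_distinguishing: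
  assumes "finite_simple_graph G" "distinguishing_coloring (subdivision_graph G) h"
  shows "distinguishing_total_coloring G h"
  unfolding distinguishing_total_coloring_def
proof (intro allI impI ballI, elim conjE)
  fix \<psi> v
  assume aut: "graph_automorphism G \<psi>" and v: "v \<in> verts G"
    and h: "\<forall>v\<in>verts G. h (Inl (\<psi> v)) = h (Inl v)" "\<forall>e\<in>edges G. h (Inr (\<psi> ` e)) = h (Inr e)"
  have "\<forall>x\<in>verts (subdivision_graph G). h (map_sum \<psi> ((`) \<psi>) x) = h x"
    using h by auto
  then have "map_sum \<psi> ((`) \<psi>) (Inl v) = Inl v"
    using assms(2) v automorphism_subdivision_of_automorphism[OF assms(1) aut]
    unfolding distinguishing_coloring_def verts_subdivision by blast
  then show "\<psi> v = v" by simp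
qed

text \<open>The assumption \<open>isl\<close> rules out automorphisms that interchange vertices and
  edges. All others are induced by G, where the coloring forces the identity, first on vertices and
  then on edges.\<close>

lemma distinguishing_if_distinguishing_total_coloring:
  assumes "finite_simple_graph G" "connected_graph G" "distinguishing_total_coloring G c"
    and isl: "\<And>\<psi> v. graph_automorphism (subdivision_graph G) \<psi> \<Longrightarrow> v \<in> verts G \<Longrightarrow>
      isl (\<psi> (Inl v))"
  shows "distinguishing_coloring (subdivision_graph G) c"
  unfolding distinguishing_coloring_def
proof (intro allI impI ballI, elim conjE)
  fix \<psi> x
  assume aut: "graph_automorphism (subdivision_graph G) \<psi>"
    and x: "x \<in> verts (subdivision_graph G)"
    and c: "\<forall>v\<in>verts (subdivision_graph G). c (\<psi> v) = c v"
  \<comment> \<open>Passing to the induced automorphism requires some vertex of G: x itself, or an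
    end of x if x is an edge.\<close>
  have "\<exists>u. u \<in> verts G"
  proof (cases x)
    case (Inr e)
    then have "e \<in> edges G" using x by auto
    then show ?thesis using assms(1) unfolding finite_simple_graph_def
      by (metis card_2_iff insert_subset)
  qed (use x in auto)
  then obtain u where u: "u \<in> verts G" ..
  obtain \<phi> where \<phi>: "graph_automorphism G \<phi>"
    "\<And>v. v \<in> verts G \<Longrightarrow> \<psi> (Inl v) = Inl (\<phi> v)" "\<And>e. e \<in> edges G \<Longrightarrow> \<psi> (Inr e) = Inr (\<phi> ` e)"
    using automorphism_subdivision_induced[OF assms(1,2) aut u isl[OF aut u]] by blast
  have id: "\<phi> v = v" if "v \<in> verts G" for v
    using assms(3)[unfolded distinguishing_total_coloring_def, rule_format, of \<phi> v] \<phi> c that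
    by (metis InlI InrI verts_subdivision)
  show "\<psi> x = x"
  proof (cases x)
    case (Inr e)
    then have "e \<in> edges G" using x by auto
    moreover from this have "e \<subseteq> verts G" using assms(1) by (simp add: finite_simple_graph_def)
    then have "\<phi> ` e = e" using id by force
    ultimately show ?thesis using Inr \<phi>(3) by simp
  qed (use x id \<phi>(2) in auto)
qed

section \<open>Connected 2-regular graphs\<close>

text \<open>If one vertex of G is mapped to an edge, then all are, and each inherits the degree 2
  that an edge has in S(G).\<close>

lemma two_regular_if_not_isl:
  assumes "finite_simple_graph G" "connected_graph G"
    and aut: "graph_automorphism (subdivision_graph G) \<psi>"
    and "u \<in> verts G" "\<not> isl (\<psi> (Inl u))" "v \<in> verts G"
  shows "card (neighbours G v) = 2"
proof -
  let ?S = "subdivision_graph G"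
  have "\<not> isl (\<psi> (Inl v))"
    using automorphism_subdivision_isl[OF assms(1-3) assms(6,4)] assms(5) by blast
  moreover have "\<psi> (Inl v) \<in> verts G <+> edges G"
    using aut assms(6) bij_betwE unfolding graph_automorphism_def by fastforce
  ultimately obtain e where e: "\<psi> (Inl v) = Inr e" "e \<in> edges G" by auto
  have "card (neighbours ?S (\<psi> (Inl v))) = card (neighbours ?S (Inl v))"
    using card_automorphism_neighbours[OF finite_simple_subdivision_graph[OF assms(1)] aut]
      assms(6) by auto
  then show ?thesis
    using e card_neighbours_subdivision_Inr[OF assms(1)]
      card_neighbours_subdivision_Inl[OF assms(1,6)] by simp
qed

text \<open>If a vertex and one of its two neighbours are fixed, then so is the other neighbour, as
  its image is again a neighbour and \<phi> is injective. This spreads from \<open>{a, b}\<close>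
  over the whole graph.\<close>

lemma two_regular_automorphism_fixing_edge:
  assumes "finite_simple_graph G" "connected_graph G"
    and reg: "\<And>v. v \<in> verts G \<Longrightarrow> card (neighbours G v) = 2"
    and aut: "graph_automorphism G \<phi>"
    and ab: "{a, b} \<in> edges G" "\<phi> a = a" "\<phi> b = b"
    and "v \<in> verts G"
  shows "\<phi> v = v"
proof -
  \<comment> \<open>The induction carries a fixed neighbour along, since an automorphism fixing only
    \<open>v\<close> may still swap its two neighbours.\<close>
  have "\<phi> v = v \<and> (\<exists>w\<in>neighbours G v. \<phi> w = w)"
    using assms(2) edgeD(1)[OF assms(1) ab(1)] assms(8)
  proof (induction rule: connected_induct)
    case base
    then show ?case using ab by (auto simp: neighbours_def)
  next
    case (step x y)
    then obtain w where w: "\<phi> x = x" "w \<in> neighbours G x" "\<phi> w = w" by blast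
    note xy = edgeD[OF assms(1) step(1)]
    have y: "y \<in> neighbours G x" using step(1) by (simp add: neighbours_def)
    have x: "x \<in> neighbours G y" using step(1) by (simp add: neighbours_def insert_commute)
    have "\<phi> y = y"
    proof (cases "y = w")
      case False
      then have nb: "neighbours G x = {w, y}"
        using reg[OF xy(1)] w(2) y by (auto simp: card_2_iff)
      have "\<phi> y \<in> {w, y}"
        using automorphism_neighbours[OF assms(1) aut xy(1)] w(1) nb by auto
      moreover have "\<phi> y \<noteq> \<phi> w"
        using aut False xy(2) edgeD(2)[OF assms(1), of x w] w(2)
        unfolding graph_automorphism_def bij_betw_def inj_on_def neighbours_def by blast
      ultimately show ?thesis using w(3) by auto
    qed (use w in simp)
    with x w(1) show ?case by blast
  qed
  then show ?thesis by blast
qed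

text \<open>Take a longest path \<open>p 0\<close>, ..., \<open>p m\<close>. The second neighbour of
  its last vertex must lie on the path and can only be \<open>p 0\<close>, so the path closes up.
  The cycle then contains all neighbours of its vertices, hence by connectedness all of G.\<close>

lemma two_regular_hamiltonian_cycle:
  assumes fsg: "finite_simple_graph G" and "connected_graph G"
    and reg: "\<And>v. v \<in> verts G \<Longrightarrow> card (neighbours G v) = 2"
    and "u \<in> verts G"
  obtains p m where "m \<ge> 2" "inj_on p {..m}" "p ` {..m} = verts G"
    "edges G = insert {p m, p (0::nat)} ((\<lambda>i. {p i, p (Suc i)}) ` {..<m})"
proof -
  define path where "path p m \<longleftrightarrow>
    inj_on p {..m} \<and> p ` {..m} \<subseteq> verts G \<and> (\<forall>i<m. {p i, p (Suc i)} \<in> edges G)"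
    for p :: "nat \<Rightarrow> 'a" and m
  have fin: "finite (verts G)" using fsg by (simp add: finite_simple_graph_def)
  \<comment> \<open>A path with index bound \<open>m\<close> has \<open>m + 1\<close> distinct
    vertices; this bound makes a longest path exist.\<close>
  have "m < card (verts G)" if "path p m" for p m
    using that card_inj_on_le[of p "{..m}" "verts G"] fin by (simp add: path_def)
  moreover have "path (\<lambda>_. u) 0" using assms(4) by (simp add: path_def)
  ultimately obtain m where "\<exists>p. path p m" and max: "\<And>p m'. path p m' \<Longrightarrow> m' \<le> m"
    using GreatestI_nat[of "\<lambda>m. \<exists>p. path p m" 0 "card (verts G)"]
      Greatest_le_nat[of "\<lambda>m. \<exists>p. path p m" _ "card (verts G)"] by (metis less_imp_le)
  then obtain p where p: "path p m" by blast
  then have inj: "inj_on p {..m}" and vs: "\<And>i. i \<le> m \<Longrightarrow> p i \<in> verts G"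
    and con: "\<And>i. i < m \<Longrightarrow> {p i, p (Suc i)} \<in> edges G"
    unfolding path_def by auto
  have inj': "p i = p j \<longleftrightarrow> i = j" if "i \<le> m" "j \<le> m" for i j
    using inj that by (auto simp: inj_on_def)
  \<comment> \<open>Otherwise the path could be prolonged by \<open>w\<close>.\<close>
  have last: "w \<in> p ` {..m}" if w: "w \<in> neighbours G (p m)" for w
  proof (rule ccontr)
    assume new: "w \<notin> p ` {..m}"
    have "{p m, w} \<in> edges G" using w by (simp add: neighbours_def)
    with new inj vs con edgeD(2)[OF fsg this] have "path (p(Suc m := w)) (Suc m)"
      unfolding path_def by (auto simp: atMost_Suc inj_on_def less_Suc_eq image_def)
    then show False using max by fastforce
  qed
  have succ: "p (Suc i) \<in> neighbours G (p i)" "p i \<in> neighbours G (p (Suc i))" if "i < m" for i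
    using con[OF that] by (simp_all add: neighbours_def insert_commute)
  have nb: "neighbours G v = {x, y}"
    if "x \<in> neighbours G v" "y \<in> neighbours G v" "x \<noteq> y" "v \<in> verts G" for v x y
    using reg[OF that(4)] that(1-3) by (auto simp: card_2_iff)
  obtain x y where xy: "neighbours G (p m) = {x, y}" "x \<noteq> y"
    using reg[OF vs[of m]] by (auto simp: card_2_iff)
  \<comment> \<open>Of the two neighbours of \<open>p m\<close>, at most one is its predecessor.
    Writing \<open>Suc i \<noteq> m\<close> instead of \<open>i \<noteq> m - 1\<close> avoids
    truncated subtraction at \<open>m = 0\<close>.\<close>
  have "\<exists>i\<le>m. p i \<in> neighbours G (p m) \<and> Suc i \<noteq> m"
  proof -
    have "x \<in> p ` {..m}" "y \<in> p ` {..m}" using last xy(1) by simp_all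
    then obtain i j where ij: "i \<le> m" "x = p i" "j \<le> m" "y = p j" by blast
    show ?thesis
    proof (cases "Suc i = m")
      case True
      then have "Suc j \<noteq> m" using ij xy(2) by auto
      with ij xy(1) show ?thesis by blast
    qed (use ij xy(1) in blast)
  qed
  then obtain i where i: "i \<le> m" "p i \<in> neighbours G (p m)" "Suc i \<noteq> m" by blast
  have "i \<noteq> m"
    using i(2) edgeD(3)[OF fsg] by (auto simp: neighbours_def)
  with i have im: "Suc i < m" by simp
  \<comment> \<open>An inner vertex \<open>p i\<close> already has its two neighbours next to it on
    the path, so \<open>p m\<close> would be a third.\<close>
  have "i = 0"
  proof (rule ccontr)
    assume "i \<noteq> 0"
    then obtain j where j: "i = Suc j" by (cases i) auto
    have "neighbours G (p i) = {p j, p (Suc i)}"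
      using nb[of "p j" "p i" "p (Suc i)"] succ[of j] succ[of i] im j inj' vs by simp
    moreover have "p m \<in> neighbours G (p i)"
      using i(2) by (simp add: neighbours_def insert_commute)
    ultimately show False using inj' im j by auto
  qed
  then have m2: "m \<ge> 2" and close: "p 0 \<in> neighbours G (p m)" "p m \<in> neighbours G (p 0)"
    using im i(2) by (auto simp: neighbours_def insert_commute)
  have nb0: "neighbours G (p 0) = {p m, p (Suc 0)}"
    using nb[of "p m" "p 0" "p (Suc 0)"] close succ[of 0] m2 inj' vs by simp
  have nbm: "neighbours G (p m) = {p (m - 1), p 0}"
    using nb[of "p (m - 1)" "p m" "p 0"] close succ[of "m - 1"] m2 inj' vs by simp
  have nbi: "neighbours G (p k) = {p (k - 1), p (Suc k)}" if "0 < k" "k < m" for k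
    using nb[of "p (k - 1)" "p k" "p (Suc k)"] succ[of "k - 1"] succ[of k] that inj' vs by simp
  let ?E = "insert {p m, p 0} ((\<lambda>i. {p i, p (Suc i)}) ` {..<m})"
  \<comment> \<open>The first conjunct lets connectedness show that the path covers
    \<open>verts G\<close>; the second then identifies the edge set.\<close>
  have inc: "w \<in> p ` {..m} \<and> {p k, w} \<in> ?E" if "k \<le> m" "w \<in> neighbours G (p k)" for k w
  proof -
    consider "k = 0" | "k = m" | "0 < k" "k < m" using \<open>k \<le> m\<close> by linarith
    then show ?thesis
    proof cases
      case 1
      then show ?thesis using that nb0 m2 by (auto simp: insert_commute)
    next
      case 2
      have "{p m, p (m - 1)} = (\<lambda>i. {p i, p (Suc i)}) (m - 1)" using m2 by (simp add: insert_commute)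
      then show ?thesis using 2 that nbm m2 by (auto simp: insert_commute)
    next
      case 3
      have "{p k, p (k - 1)} = (\<lambda>i. {p i, p (Suc i)}) (k - 1)" using 3 by (simp add: insert_commute)
      moreover have "k - 1 < m" using 3 by simp
      ultimately have "{p k, p (k - 1)} \<in> ?E" by blast
      then show ?thesis using 3 that nbi by auto
    qed
  qed
  have "v \<in> p ` {..m}" if "v \<in> verts G" for v
    using assms(2) vs[of 0, simplified] that
    by (induction rule: connected_induct) (use inc in \<open>auto simp: neighbours_def\<close>)
  then have surj: "p ` {..m} = verts G" using vs by auto
  have "edges G = ?E"
  proof
    show "?E \<subseteq> edges G" using con close by (auto simp: neighbours_def)
    show "edges G \<subseteq> ?E"
    proof
      fix e assume e: "e \<in> edges G"
      then obtain a b where ab: "e = {a, b}"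
        using fsg unfolding finite_simple_graph_def by (meson card_2_iff)
      then have "a \<in> p ` {..m}" using edgeD(1)[OF fsg] e surj by blast
      then obtain k where "k \<le> m" "a = p k" by blast
      then show "e \<in> ?E" using inc[of k b] e ab by (simp add: neighbours_def)
    qed
  qed
  with that m2 inj surj show ?thesis by blast
qed

text \<open>The reflection that sends index \<open>i\<close> to \<open>m - i\<close> maps the
  closing edge to itself and moves \<open>p 0\<close> to \<open>p m\<close>.\<close>

lemma two_regular_nontrivial_automorphism:
  assumes fsg: "finite_simple_graph G" and "connected_graph G"
    and reg: "\<And>v. v \<in> verts G \<Longrightarrow> card (neighbours G v) = 2"
    and "u \<in> verts G"
  obtains \<phi> v where "graph_automorphism G \<phi>" "v \<in> verts G" "\<phi> v \<noteq> v"
proof -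
  obtain p m where m: "m \<ge> 2" and inj: "inj_on p {..m}" and vs: "p ` {..m} = verts G"
    and E: "edges G = insert {p m, p (0::nat)} ((\<lambda>i. {p i, p (Suc i)}) ` {..<m})"
    by (rule two_regular_hamiltonian_cycle[OF assms])
  define \<phi> where "\<phi> v = p (m - inv_into {..m} p v)" for v
  have \<phi>: "\<phi> (p i) = p (m - i)" if "i \<le> m" for i
    using inv_into_f_f[OF inj] that by (simp add: \<phi>_def)
  have invol: "\<phi> v \<in> verts G \<and> \<phi> (\<phi> v) = v" if v: "v \<in> verts G" for v
  proof -
    obtain i where "i \<le> m" "v = p i" using v vs by blast
    then show ?thesis using vs by (auto simp: \<phi>)
  qed
  have bij: "bij_betw \<phi> (verts G) (verts G)"
    by (rule bij_betw_byWitness[of _ \<phi>]) (use invol in auto)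
  have fwd: "{\<phi> a, \<phi> b} \<in> edges G" if ab: "{a, b} \<in> edges G" for a b
  proof -
    have "\<phi> ` e \<in> edges G" if "e \<in> edges G" for e
    proof -
      consider "e = {p m, p 0}" | i where "i < m" "e = {p i, p (Suc i)}" using \<open>e \<in> edges G\<close> E by auto
      then show ?thesis
      proof cases
        case 1
        then show ?thesis using E by (simp add: \<phi> insert_commute)
      next
        case 2
        \<comment> \<open>The edge with index \<open>i\<close> becomes the one with index
          \<open>m - Suc i\<close>, with its ends reversed.\<close>
        then have "\<phi> ` e = {p (m - Suc i), p (Suc (m - Suc i))}"
          by (simp add: \<phi> insert_commute Suc_diff_Suc)
        moreover have "m - Suc i < m" using 2 by simp
        ultimately show ?thesis unfolding E by blast
      qed
    qed
    from this[OF ab] show ?thesis by simp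
  qed
  \<comment> \<open>As \<phi> is an involution, \<open>fwd\<close> applied to the images gives the
    converse implication for edges.\<close>
  have "graph_automorphism G \<phi>"
    unfolding graph_automorphism_def using bij fwd invol by metis
  moreover have "\<phi> (p 0) \<noteq> p 0"
    using m inj_onD[OF inj, of m 0] by (auto simp: \<phi>)
  moreover have "p 0 \<in> verts G" using vs by blast
  ultimately show ?thesis using that by blast
qed

text \<open>For a path a, u, b the first color class is chosen so that preserving it forces
  \<open>Inl a\<close> and the edge \<open>{a, u}\<close> to be fixed. Then u is fixed too, and an
  automorphism of a connected 2-regular graph that fixes both ends of an edge is the
  identity.\<close>

lemma two_regular_two_coloring:
  assumes fsg: "finite_simple_graph G" and con: "connected_graph G"
    and reg: "\<And>v. v \<in> verts G \<Longrightarrow> card (neighbours G v) = 2"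
    and "u \<in> verts G"
  obtains h where "range h \<subseteq> {1..2::nat}" "distinguishing_coloring (subdivision_graph G) h"
proof -
  let ?S = "subdivision_graph G"
  obtain a b where ab: "neighbours G u = {a, b}" "a \<noteq> b"
    using reg[OF assms(4)] by (auto simp: card_2_iff)
  define e f where "e = {a, u}" and "f = {u, b}"
  have ef: "{a, u} \<in> edges G" "{u, b} \<in> edges G"
    using ab by (auto simp: neighbours_def insert_commute)
  note v = edgeD[OF fsg ef(1)] edgeD[OF fsg ef(2)]
  \<comment> \<open>In S(G) this set spans just one edge, between \<open>Inl a\<close> and
    \<open>Inr e\<close>; \<open>Inr f\<close> is isolated in it.\<close>
  define C where "C = {Inl a, Inr e, Inr f}"
  define h where "h x = (if x \<in> C then 1 else 2::nat)" for x
  have "distinguishing_coloring ?S h"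
    unfolding distinguishing_coloring_def
  proof (intro allI impI ballI, elim conjE)
    fix \<psi> x
    assume aut: "graph_automorphism ?S \<psi>" and x: "x \<in> verts ?S"
      and h: "\<forall>v\<in>verts ?S. h (\<psi> v) = h v"
    have CS: "C \<subseteq> verts ?S" using v ef by (auto simp: C_def e_def f_def)
    have inj: "inj_on \<psi> (verts ?S)"
      and adj: "\<And>x y. x \<in> verts ?S \<Longrightarrow> y \<in> verts ?S \<Longrightarrow>
        {\<psi> x, \<psi> y} \<in> edges ?S \<longleftrightarrow> {x, y} \<in> edges ?S"
      using aut unfolding graph_automorphism_def bij_betw_def by auto
    have hC: "\<psi> x \<in> C" if "x \<in> C" for x
      using h CS that by (auto simp: h_def split: if_splits)
    have dist: "\<psi> (Inl a) \<noteq> \<psi> (Inr e)" "\<psi> (Inl a) \<noteq> \<psi> (Inr f)" "\<psi> (Inr e) \<noteq> \<psi> (Inr f)"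
      using inj CS v ab(2) unfolding C_def e_def f_def
      by (auto simp: inj_on_def doubleton_eq_iff)
    have ae: "{\<psi> (Inl a), \<psi> (Inr e)} \<in> edges ?S"
      using adj[of "Inl a" "Inr e"] CS v ef by (simp add: C_def e_def)
    have nf: "a \<notin> f" using v ab by (auto simp: f_def)
    \<comment> \<open>The only edge of S(G) inside \<open>C\<close> is mapped to itself, with its
      ends either kept or swapped.\<close>
    have cases: "\<psi> (Inl a) = Inl a \<and> \<psi> (Inr e) = Inr e \<or>
        \<psi> (Inl a) = Inr e \<and> \<psi> (Inr e) = Inl a \<and> \<psi> (Inr f) = Inr f"
      using ae hC[of "Inl a"] hC[of "Inr e"] hC[of "Inr f"] dist nf unfolding C_def by auto
    text \<open>In the second case \<open>\<psi>\<close> would map \<open>u\<close> to a common neighbour of a vertex and an edge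
      of \<open>G\<close>.\<close>
    have "{\<psi> (Inl u), \<psi> (Inr e)} \<in> edges ?S" "{\<psi> (Inl u), \<psi> (Inr f)} \<in> edges ?S"
      using adj[of "Inl u" "Inr e"] adj[of "Inl u" "Inr f"] v ef by (auto simp: e_def f_def)
    then have fixed: "\<psi> (Inl a) = Inl a" "\<psi> (Inr e) = Inr e"
      using cases by (cases "\<psi> (Inl u)"; auto)+
    obtain \<phi> where \<phi>: "graph_automorphism G \<phi>"
      "\<And>v. v \<in> verts G \<Longrightarrow> \<psi> (Inl v) = Inl (\<phi> v)" "\<And>e. e \<in> edges G \<Longrightarrow> \<psi> (Inr e) = Inr (\<phi> ` e)"
      using automorphism_subdivision_induced[OF fsg con aut v(1)] fixed(1) by auto
    have a: "\<phi> a = a" using \<phi>(2)[OF v(1)] fixed by simp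
    have "\<phi> ` e = e" using \<phi>(3) ef(1) fixed(2) by (simp add: e_def)
    then have u: "\<phi> u = u" using a by (auto simp: e_def doubleton_eq_iff)
    have id: "\<phi> w = w" if "w \<in> verts G" for w
      using two_regular_automorphism_fixing_edge[OF fsg con reg \<phi>(1) ef(1) a u that] .
    show "\<psi> x = x"
    proof (cases x)
      case (Inr e')
      then have "e' \<in> edges G" using x by auto
      moreover from this have "e' \<subseteq> verts G" using fsg by (simp add: finite_simple_graph_def)
      then have "\<phi> ` e' = e'" using id by force
      ultimately show ?thesis using Inr \<phi>(3) by simp
    qed (use x id \<phi>(2) in auto)
  qed
  moreover have "range h \<subseteq> {1..2}" by (auto simp: h_def)
  ultimately show ?thesis using that by blast
qed

section \<open>Bounds on the two minima and their equality\<close>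

lemma distinguishing_number_le:
  assumes "h ` verts H \<subseteq> {1..r}" "distinguishing_coloring H h"
  shows "distinguishing_number H \<le> r"
  unfolding distinguishing_number_def using assms by (blast intro: Least_le)

lemma total_distinguishing_number_le:
  assumes "c ` (verts G <+> edges G) \<subseteq> {1..d}" "distinguishing_total_coloring G c"
  shows "total_distinguishing_number G \<le> d"
  unfolding total_distinguishing_number_def using assms by (blast intro: Least_le)

text \<open>With at most one color every total coloring is constant, so any nontrivial automorphism
  preserves it.\<close>

lemma total_distinguishing_number_ge_2:
  assumes fsg: "finite_simple_graph G"
    and aut: "graph_automorphism G \<phi>" "v \<in> verts G" "\<phi> v \<noteq> v"
  shows "total_distinguishing_number G \<ge> 2"
proof (rule ccontr)
  assume "\<not> total_distinguishing_number G \<ge> 2"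
  then have "{1..total_distinguishing_number G} \<subseteq> {1}" by auto
  then obtain c where c: "c ` (verts G <+> edges G) \<subseteq> {1}" "distinguishing_total_coloring G c"
    using total_distinguishing_number_attained[OF fsg] by (meson subset_trans)
  have one: "c x = 1" if "x \<in> verts G <+> edges G" for x using c(1) that by blast
  \<comment> \<open>That edges are mapped to edges is read off from the extension of \<phi> to
    S(G).\<close>
  have "map_sum \<phi> ((`) \<phi>) x \<in> verts G <+> edges G" if "x \<in> verts G <+> edges G" for x
    using automorphism_subdivision_of_automorphism[OF fsg aut(1)] that
    unfolding graph_automorphism_def by (auto dest: bij_betwE)
  then have "c (map_sum \<phi> ((`) \<phi>) x) = c x" if "x \<in> verts G <+> edges G" for x
    using that one by metis
  from this[of "Inl _"] this[of "Inr _"]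
  have "\<forall>v\<in>verts G. c (Inl (\<phi> v)) = c (Inl v)" "\<forall>e\<in>edges G. c (Inr (\<phi> ` e)) = c (Inr e)"
    by auto
  then show False
    using c(2) aut unfolding distinguishing_total_coloring_def by blast
qed

theorem theorem3p3:
  fixes G :: "'a graph" and n :: nat
  assumes "finite_simple_graph G"
    and "connected_graph G"
    and "card (verts G) = n"
    and "n \<ge> 3"
  shows "total_distinguishing_number G = distinguishing_number (subdivision_graph G)"
proof (rule antisym)
  show "total_distinguishing_number G \<le> distinguishing_number (subdivision_graph G)"
    using distinguishing_number_attained[OF finite_simple_subdivision_graph[OF assms(1)]]
      distinguishing_total_coloring_if_distinguishing[OF assms(1)]
      total_distinguishing_number_le by (metis verts_subdivision)
  show "distinguishing_number (subdivision_graph G) \<le> total_distinguishing_number G"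
  proof (cases "\<forall>\<psi> v. graph_automorphism (subdivision_graph G) \<psi> \<longrightarrow> v \<in> verts G \<longrightarrow>
      isl (\<psi> (Inl v))")
    case True
    then show ?thesis
      using total_distinguishing_number_attained[OF assms(1)]
        distinguishing_if_distinguishing_total_coloring[OF assms(1,2)]
        distinguishing_number_le by (metis verts_subdivision)
  next
    case False
    \<comment> \<open>No coloring is transferred in this case; the inequality comes from D(S(G))
      \<le> 2 \<le> D''(G).\<close>
    then obtain \<psi> u where \<psi>: "graph_automorphism (subdivision_graph G) \<psi>" "u \<in> verts G"
      "\<not> isl (\<psi> (Inl u))" by blast
    note reg = two_regular_if_not_isl[OF assms(1,2) \<psi>]
    obtain \<phi> v where "graph_automorphism G \<phi>" "v \<in> verts G" "\<phi> v \<noteq> v"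
      by (rule two_regular_nontrivial_automorphism[OF assms(1,2) reg \<psi>(2)])
    then have "2 \<le> total_distinguishing_number G"
      by (rule total_distinguishing_number_ge_2[OF assms(1)])
    moreover obtain h where "range h \<subseteq> {1..2::nat}"
      "distinguishing_coloring (subdivision_graph G) h"
      by (rule two_regular_two_coloring[OF assms(1,2) reg \<psi>(2)])
    then have "distinguishing_number (subdivision_graph G) \<le> 2"
      by (intro distinguishing_number_le) auto
    ultimately show ?thesis by linarith
  qed
qed

end
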